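(* Let $n$ be an integer which is either even with $n\geq 4$ or odd with $n\geq 7$. Let $R=\mathbb{Q}[x_1,\ldots,x_{n+2}]$, let $I_n=(x_1x_2,x_2x_3,\ldots,x_{n-1}x_n,x_nx_1)\subset R$ be the edge ideal of the $n$-cycle, let $J_n=(x_n,x_1)\cap\bigcap_{1\le i\le n-1}(x_i,x_{i+1})\subset R$ be the cover ideal of the $n$-cycle, and let $L_n=x_{n+1}I_n+x_{n+2}J_n\subset R$. Then for every integer $i\geq 3$ the ideal $L_n^i$ is not integrally closed.
   Context: For an ideal $I$ of a commutative ring $R$, an element $f\in R$ is integral over $I$ if there is an equation $f^k+c_1f^{k-1}+\cdots+c_{k-1}f+c_k=0$ with $c_i\in I^i$. The set $\overline{I}$ of elements integral over $I$ is the integral closure of $I$, and $I$ is integrally closed if $I=\overline{I}$. *)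

theory Defs
  imports Complex_Main "HOL-Algebra.Coset" "HOL-Algebra.Ideal_Product" "HOL-Library.Poly_Mapping"
begin

section \<open>Integral closure of ideals\<close>

text \<open>The power of an ideal is taken in the library monoid \<^const>\<open>ideals_set\<close> of ideals of \<open>R\<close>
  under the ideal product, so the zeroth power is the unit ideal.\<close>

abbreviation ideal_power :: "('a, 'b) ring_scheme \<Rightarrow> 'a set \<Rightarrow> nat \<Rightarrow> 'a set"
  where "ideal_power R I k \<equiv> I [^]\<^bsub>ideals_set R\<^esub> k"

definition integral_over_ideal :: "('a, 'b) ring_scheme \<Rightarrow> 'a set \<Rightarrow> 'a \<Rightarrow> bool"
  where "integral_over_ideal R I f \<longleftrightarrow>
    f \<in> carrier R \<and>
    (\<exists>k c. k \<ge> 1 \<and> (\<forall>j\<in>{1..k}. c j \<in> ideal_power R I j) \<and>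
      f [^]\<^bsub>R\<^esub> k \<oplus>\<^bsub>R\<^esub> (\<Oplus>\<^bsub>R\<^esub>j\<in>{1..k}. c j \<otimes>\<^bsub>R\<^esub> f [^]\<^bsub>R\<^esub> (k - j)) = \<zero>\<^bsub>R\<^esub>)"

definition integral_closure_ideal :: "('a, 'b) ring_scheme \<Rightarrow> 'a set \<Rightarrow> 'a set"
  where "integral_closure_ideal R I = {f. integral_over_ideal R I f}"

definition integrally_closed_ideal :: "('a, 'b) ring_scheme \<Rightarrow> 'a set \<Rightarrow> bool"
  where "integrally_closed_ideal R I \<longleftrightarrow> I = integral_closure_ideal R I"


section \<open>Polynomial rings\<close>

text \<open>A monomial is a finitely supported exponent vector \<^typ>\<open>'v \<Rightarrow>\<^sub>0 nat\<close>; a polynomial is a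
  finitely supported map from monomials to coefficients, multiplied by convolution.
  The carrier consists of the polynomials that involve only variables from \<open>V\<close>.\<close>

definition mpoly_ring :: "'v set \<Rightarrow> (('v \<Rightarrow>\<^sub>0 nat) \<Rightarrow>\<^sub>0 'a::comm_ring_1) ring"
  where "mpoly_ring V =
    \<lparr>carrier = {p. \<forall>m\<in>Poly_Mapping.keys p. Poly_Mapping.keys m \<subseteq> V},
     mult = (*), one = 1, zero = 0, add = (+)\<rparr>"

definition mpoly_var :: "'v \<Rightarrow> (('v \<Rightarrow>\<^sub>0 nat) \<Rightarrow>\<^sub>0 'a::comm_ring_1)"
  where "mpoly_var v = Poly_Mapping.single (Poly_Mapping.single v 1) 1"

lemma mpoly_ring_cring: "cring (mpoly_ring V)"
proof (rule cringI)
  show "abelian_group (mpoly_ring V :: (('a \<Rightarrow>\<^sub>0 nat) \<Rightarrow>\<^sub>0 'b::comm_ring_1) ring)"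
  proof (rule abelian_groupI)
    fix x y :: "('a \<Rightarrow>\<^sub>0 nat) \<Rightarrow>\<^sub>0 'b"
    assume "x \<in> carrier (mpoly_ring V)" "y \<in> carrier (mpoly_ring V)"
    then show "x \<oplus>\<^bsub>mpoly_ring V\<^esub> y \<in> carrier (mpoly_ring V)"
      using Poly_Mapping.keys_add[of x y] by (auto simp: mpoly_ring_def)
  next
    fix x :: "('a \<Rightarrow>\<^sub>0 nat) \<Rightarrow>\<^sub>0 'b"
    assume "x \<in> carrier (mpoly_ring V)"
    then show "\<exists>y\<in>carrier (mpoly_ring V). y \<oplus>\<^bsub>mpoly_ring V\<^esub> x = \<zero>\<^bsub>mpoly_ring V\<^esub>"
      by (intro bexI[of _ "- x"]) (auto simp: mpoly_ring_def)
  qed (auto simp: mpoly_ring_def algebra_simps)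
  show "comm_monoid (mpoly_ring V :: (('a \<Rightarrow>\<^sub>0 nat) \<Rightarrow>\<^sub>0 'b::comm_ring_1) ring)"
  proof (rule comm_monoidI)
    fix x y :: "('a \<Rightarrow>\<^sub>0 nat) \<Rightarrow>\<^sub>0 'b"
    assume xy: "x \<in> carrier (mpoly_ring V)" "y \<in> carrier (mpoly_ring V)"
    have "Poly_Mapping.keys m \<subseteq> V" if m: "m \<in> Poly_Mapping.keys (x * y)" for m
    proof -
      obtain a b where ab: "m = a + b" "a \<in> Poly_Mapping.keys x" "b \<in> Poly_Mapping.keys y"
        using m Poly_Mapping.keys_mult[of x y] by blast
      then show ?thesis
        using xy Poly_Mapping.keys_add[of a b] by (fastforce simp: mpoly_ring_def)
    qed
    then show "x \<otimes>\<^bsub>mpoly_ring V\<^esub> y \<in> carrier (mpoly_ring V)"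
      by (simp add: mpoly_ring_def)
  qed (auto simp: mpoly_ring_def algebra_simps)
qed (auto simp: mpoly_ring_def algebra_simps)

lemma mpoly_var_in_carrier: "v \<in> V \<Longrightarrow> mpoly_var v \<in> carrier (mpoly_ring V)"
  by (simp add: mpoly_ring_def mpoly_var_def)


section \<open>Edge and cover ideals of cycles\<close>

abbreviation X :: "nat \<Rightarrow> ((nat \<Rightarrow>\<^sub>0 nat) \<Rightarrow>\<^sub>0 rat)"
  where "X \<equiv> mpoly_var"

definition cycle_ring :: "nat \<Rightarrow> ((nat \<Rightarrow>\<^sub>0 nat) \<Rightarrow>\<^sub>0 rat) ring"
  where "cycle_ring n = mpoly_ring {1..n + 2}"

definition cycle_edge_ideal :: "nat \<Rightarrow> ((nat \<Rightarrow>\<^sub>0 nat) \<Rightarrow>\<^sub>0 rat) set"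
  where "cycle_edge_ideal n =
    Idl\<^bsub>cycle_ring n\<^esub>
      ({X i \<otimes>\<^bsub>cycle_ring n\<^esub> X (i + 1) | i. 1 \<le> i \<and> i \<le> n - 1}
       \<union> {X n \<otimes>\<^bsub>cycle_ring n\<^esub> X 1})"

definition cycle_cover_ideal :: "nat \<Rightarrow> ((nat \<Rightarrow>\<^sub>0 nat) \<Rightarrow>\<^sub>0 rat) set"
  where "cycle_cover_ideal n =
    Idl\<^bsub>cycle_ring n\<^esub> {X n, X 1}
      \<inter> (\<Inter>i\<in>{1..n - 1}. Idl\<^bsub>cycle_ring n\<^esub> {X i, X (i + 1)})"

text \<open>Here \<open>x <#\<^bsub>R\<^esub> I\<close> is the multiplicative translate \<open>{x \<otimes>\<^bsub>R\<^esub> f | f. f \<in> I}\<close>,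
  that is, the ideal \<open>x I\<close>.\<close>

definition cycle_L_ideal :: "nat \<Rightarrow> ((nat \<Rightarrow>\<^sub>0 nat) \<Rightarrow>\<^sub>0 rat) set"
  where "cycle_L_ideal n =
    (X (n + 1) <#\<^bsub>cycle_ring n\<^esub> cycle_edge_ideal n)
      <+>\<^bsub>cycle_ring n\<^esub> (X (n + 2) <#\<^bsub>cycle_ring n\<^esub> cycle_cover_ideal n)"

end

theory Submission
  imports Defs
begin

text \<open>Write \<open>y = x\<^bsub>n+1\<^esub>\<close> and \<open>z = x\<^bsub>n+2\<^esub>\<close>. The part of \<open>L\<^sup>i\<close> of
  degree \<open>(1, b)\<close> in \<open>(y, z)\<close>, where \<open>b = i - 1\<close>, is \<open>y z\<^sup>b I J\<^sup>b\<close>, so it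
  suffices to find a monomial \<open>x\<^sup>M\<close> outside \<open>I J\<^sup>b\<close> whose square lies in \<open>(I J\<^sup>b)\<^sup>2\<close>.
  A monomial of \<open>I J\<^sup>b\<close> is divisible by an edge after whose removal all edges still have
  degree at least \<open>b\<close>. For even \<open>n\<close>, let \<open>M\<close> be \<open>b\<close> on the even and \<open>1\<close> on the odd vertices: all
  edges have degree \<open>b + 1\<close>, so removing an edge lowers its own degree to \<open>b - 1\<close>. For odd \<open>n\<close>, let
  \<open>M\<close> be \<open>b\<close> on \<open>1\<close> and the even vertices, \<open>1\<close> on \<open>3, 5, \<dots>, n - 2\<close> and \<open>0\<close> on \<open>n\<close>: all edges
  other than \<open>{1, 2}\<close> have degree at most \<open>b + 1\<close>, and removing \<open>{1, 2}\<close> lowers the degree of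
  \<open>{n, 1}\<close> to \<open>b - 1\<close>. In both cases \<open>x\<^sup>M x\<^sup>M\<close> is divisible by two disjoint edges, a cover \<open>C\<close> and
  \<open>2 b - 1\<close> copies of a cover \<open>A\<close>.\<close>

section \<open>Ideals in commutative rings\<close>

context cring
begin

lemma ideal_ideal_power: "ideal I R \<Longrightarrow> ideal (ideal_power R I k) R"
  by (induction k) (auto simp: ideals_set_def oneideal ideal_prod_is_ideal)

lemma mult_mem_ideal_power_Suc:
  "a \<in> ideal_power R I k \<Longrightarrow> b \<in> I \<Longrightarrow> a \<otimes> b \<in> ideal_power R I (Suc k)"
  by (auto simp: ideals_set_def intro: ideal_prod.prod)

text \<open>Needed because \<open>cycle_L_ideal\<close> is a sum of two such translates.\<close>

lemma ideal_l_coset: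
  assumes "ideal I R" "x \<in> carrier R"
  shows "ideal (x <# I) R"
proof -
  interpret I: ideal I R by fact
  have I: "a \<in> carrier R" if "a \<in> I" for a
    using that by (rule I.Icarr)
  show ?thesis
  proof (rule idealI)
    show "subgroup (x <# I) (add_monoid R)"
    proof
      show "x <# I \<subseteq> carrier (add_monoid R)"
        using I assms(2) by (auto simp: l_coset_def)
      show "\<one>\<^bsub>add_monoid R\<^esub> \<in> x <# I"
        using assms(2) by (auto simp: l_coset_def intro!: bexI[of _ \<zero>])
    next
      fix u v assume "u \<in> x <# I" "v \<in> x <# I"
      then obtain a b where "a \<in> I" "b \<in> I" "u = x \<otimes> a" "v = x \<otimes> b"
        by (auto simp: l_coset_def)
      then show "u \<otimes>\<^bsub>add_monoid R\<^esub> v \<in> x <# I"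
        using I assms(2) by (auto simp: l_coset_def r_distr intro!: bexI[of _ "a \<oplus> b"])
    next
      fix u assume "u \<in> x <# I"
      then obtain a where a: "a \<in> I" "u = x \<otimes> a"
        by (auto simp: l_coset_def)
      then have "inv\<^bsub>add_monoid R\<^esub> u = x \<otimes> (\<ominus> a)"
        using I assms(2) by (simp add: a_inv_def[symmetric] r_minus)
      then show "inv\<^bsub>add_monoid R\<^esub> u \<in> x <# I"
        using a by (auto simp: l_coset_def)
    qed
  next
    fix u r assume u: "u \<in> x <# I" and r: "r \<in> carrier R"
    then obtain a where a: "a \<in> I" "u = x \<otimes> a"
      by (auto simp: l_coset_def)
    have "r \<otimes> u = x \<otimes> (r \<otimes> a)" "u \<otimes> r = x \<otimes> (r \<otimes> a)"
      using a r I assms(2) by (simp_all add: m_ac)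
    then show "r \<otimes> u \<in> x <# I" "u \<otimes> r \<in> x <# I"
      using a r I.I_l_closed by (auto simp: l_coset_def)
  qed (rule ring_axioms)
qed

text \<open>The equation of integral dependence is \<open>f^2 - g h = 0\<close>, with
  \<open>c 1 = 0\<close> and \<open>c 2 = - g h\<close>.\<close>

lemma integral_over_ideal_of_square:
  assumes I: "ideal I R" and g: "g \<in> I" and h: "h \<in> I" and f: "f \<in> carrier R"
    and eq: "f \<otimes> f = g \<otimes> h"
  shows "integral_over_ideal R I f"
proof -
  interpret I: ideal I R by fact
  have gh: "g \<in> carrier R" "h \<in> carrier R"
    using g h by (auto intro: I.Icarr)
  define c where "c j = (if j = 2 then \<ominus> (g \<otimes> h) else \<zero>)" for j :: nat
  \<comment> \<open>Powers are built up from the unit ideal, so the first power unfolds to the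
    product of the unit ideal with \<open>I\<close>.\<close>
  have I1: "ideal_power R I 1 = I"
    using I by (simp add: ideals_set_def ideal_prod_commute[OF oneideal] ideal_prod_one)
  have "\<ominus> (g \<otimes> h) = (\<ominus> g) \<otimes> h"
    using gh by (simp add: l_minus)
  then have "\<ominus> (g \<otimes> h) \<in> ideal_power R I 2"
    using mult_mem_ideal_power_Suc[of "\<ominus> g" I 1 h] g h by (simp only: I1) (simp add: numeral_2_eq_2)
  then have c: "\<forall>j\<in>{1..2}. c j \<in> ideal_power R I j"
    using I1 by (auto simp: c_def numeral_2_eq_2 le_Suc_eq)
  have "{1..2} = insert 1 {2::nat}"
    by auto
  then have "(\<Oplus>j\<in>{1..2}. c j \<otimes> f [^] (2 - j)) = \<ominus> (g \<otimes> h)"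
    using gh f by (simp add: c_def)
  then have "f [^] (2::nat) \<oplus> (\<Oplus>j\<in>{1..2}. c j \<otimes> f [^] (2 - j)) = \<zero>"
    using gh f eq by (simp add: numeral_2_eq_2 r_neg)
  then show ?thesis
    using f c unfolding integral_over_ideal_def by (intro conjI exI[of _ "2::nat"] exI[of _ c]) auto
qed

end

section \<open>Sets of polynomials with restricted monomials\<close>

text \<open>If \<open>Q\<close> is preserved by adding exponents, this is a monomial ideal.
  Inclusion in such a set replaces the explicit computation of ideals and their powers.\<close>

definition supported_polys ::
    "'v set \<Rightarrow> (('v \<Rightarrow>\<^sub>0 nat) \<Rightarrow> bool) \<Rightarrow> (('v \<Rightarrow>\<^sub>0 nat) \<Rightarrow>\<^sub>0 'a::comm_ring_1) set"
  where "supported_polys V Q = {p \<in> carrier (mpoly_ring V). \<forall>m\<in>Poly_Mapping.keys p. Q m}"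

lemma supported_polys_add:
  "p \<in> supported_polys V Q \<Longrightarrow> q \<in> supported_polys V Q \<Longrightarrow> p + q \<in> supported_polys V Q"
  using Poly_Mapping.keys_add[of p q] by (fastforce simp: supported_polys_def mpoly_ring_def)

text \<open>Cancellation can only remove monomials, so every exponent vector of \<open>p * q\<close>
  is the sum of one of \<open>p\<close> and one of \<open>q\<close>.\<close>

lemma supported_polys_mult:
  assumes "p \<in> supported_polys V Q" "q \<in> supported_polys V Q'"
    and "\<And>a b. Q a \<Longrightarrow> Q' b \<Longrightarrow> Q'' (a + b)"
  shows "p * q \<in> supported_polys V Q''"
proof -
  interpret cring "mpoly_ring V :: (('a \<Rightarrow>\<^sub>0 nat) \<Rightarrow>\<^sub>0 'b) ring"
    by (rule mpoly_ring_cring)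
  have "p * q \<in> carrier (mpoly_ring V)"
    using m_closed[of p q] assms(1,2) by (auto simp: supported_polys_def mpoly_ring_def)
  then show ?thesis
    using assms Poly_Mapping.keys_mult[of p q] by (fastforce simp: supported_polys_def)
qed

lemma ideal_supported_polys:
  assumes "\<And>a b. Q a \<Longrightarrow> Q (a + b)"
  shows "ideal (supported_polys V Q) (mpoly_ring V :: (('v \<Rightarrow>\<^sub>0 nat) \<Rightarrow>\<^sub>0 'a::comm_ring_1) ring)"
proof -
  let ?R = "mpoly_ring V :: (('v \<Rightarrow>\<^sub>0 nat) \<Rightarrow>\<^sub>0 'a) ring"
  interpret cring ?R
    by (rule mpoly_ring_cring)
  show ?thesis
  proof (rule idealI)
    show "subgroup (supported_polys V Q) (add_monoid ?R)"
    proof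
      fix p :: "('v \<Rightarrow>\<^sub>0 nat) \<Rightarrow>\<^sub>0 'a" assume p: "p \<in> supported_polys V Q"
      then have mp: "- p \<in> supported_polys V Q"
        by (auto simp: supported_polys_def mpoly_ring_def)
      have "inv\<^bsub>add_monoid ?R\<^esub> p = - p"
        using p mp by (intro add.inv_equality[unfolded a_inv_def])
          (auto simp: supported_polys_def mpoly_ring_def)
      then show "inv\<^bsub>add_monoid ?R\<^esub> p \<in> supported_polys V Q"
        using mp by simp
    next
      fix p q :: "('v \<Rightarrow>\<^sub>0 nat) \<Rightarrow>\<^sub>0 'a"
      assume "p \<in> supported_polys V Q" "q \<in> supported_polys V Q"
      then show "p \<otimes>\<^bsub>add_monoid ?R\<^esub> q \<in> supported_polys V Q"
        using supported_polys_add[of p V Q q] by (simp add: mpoly_ring_def)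
    qed (auto simp: supported_polys_def mpoly_ring_def)
  next
    fix p q :: "('v \<Rightarrow>\<^sub>0 nat) \<Rightarrow>\<^sub>0 'a"
    assume p: "p \<in> supported_polys V Q" and q: "q \<in> carrier ?R"
    have "p * q \<in> supported_polys V Q"
      by (rule supported_polys_mult[where Q = Q and Q' = "\<lambda>_. True"])
        (use p q assms in \<open>auto simp: supported_polys_def\<close>)
    then show "q \<otimes>\<^bsub>?R\<^esub> p \<in> supported_polys V Q" "p \<otimes>\<^bsub>?R\<^esub> q \<in> supported_polys V Q"
      by (simp_all add: mpoly_ring_def mult.commute)
  qed (rule ring_axioms)
qed

text \<open>Sums of products keep the support condition. The family \<open>Q\<close> is indexed by
  the power so that the condition can grow with \<open>k\<close>; \<open>Q 0\<close> is vacuous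
  because the zeroth power is the unit ideal.\<close>

lemma ideal_power_subset_supported_polys:
  assumes "I \<subseteq> supported_polys V (Q 1)" "\<And>a. Q 0 a"
    and "\<And>k a b. Q k a \<Longrightarrow> Q 1 b \<Longrightarrow> Q (Suc k) (a + b)"
  shows "ideal_power (mpoly_ring V) I k \<subseteq> supported_polys V (Q k)"
proof (induction k)
  case 0
  then show ?case
    using assms(2) by (auto simp: ideals_set_def supported_polys_def)
next
  case (Suc k)
  have "p \<in> supported_polys V (Q (Suc k))"
    if "p \<in> ideal_prod (mpoly_ring V) (ideal_power (mpoly_ring V) I k) I" for p
    using that
  proof induction
    case (prod p q)
    then show ?case
      using Suc assms(1,3) supported_polys_mult[of p V "Q k" q "Q 1" "Q (Suc k)"]
      by (auto simp: mpoly_ring_def)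
  next
    case (sum p q)
    then show ?case
      by (simp add: supported_polys_add mpoly_ring_def)
  qed
  then show ?case
    by (auto simp: ideals_set_def)
qed

section \<open>Monomials of the ring of the cycle\<close>

text \<open>Lets exponents be handled as plain functions. Values outside \<open>{1..n + 2}\<close>
  are discarded, so functions that agree on that range give the same monomial.\<close>

definition exponent_vector :: "nat \<Rightarrow> (nat \<Rightarrow> nat) \<Rightarrow> (nat \<Rightarrow>\<^sub>0 nat)"
  where "exponent_vector n f = (\<Sum>v\<in>{1..n + 2}. Poly_Mapping.single v (f v))"

definition cycle_monom :: "nat \<Rightarrow> (nat \<Rightarrow> nat) \<Rightarrow> ((nat \<Rightarrow>\<^sub>0 nat) \<Rightarrow>\<^sub>0 rat)"
  where "cycle_monom n f = Poly_Mapping.single (exponent_vector n f) 1"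

lemma lookup_exponent_vector:
  "Poly_Mapping.lookup (exponent_vector n f) v = (if v \<in> {1..n + 2} then f v else 0)"
  unfolding exponent_vector_def lookup_sum lookup_single when_def by (rule sum.delta) simp

lemma keys_cycle_monom: "Poly_Mapping.keys (cycle_monom n f) = {exponent_vector n f}"
  by (simp add: cycle_monom_def)

lemma cycle_monom_in_carrier: "cycle_monom n f \<in> carrier (cycle_ring n)"
  by (auto simp: cycle_ring_def mpoly_ring_def keys_cycle_monom in_keys_iff lookup_exponent_vector
      split: if_splits)

lemma cycle_monom_eq_iff: "cycle_monom n f = cycle_monom n g \<longleftrightarrow> (\<forall>v\<in>{1..n + 2}. f v = g v)"
proof
  assume "cycle_monom n f = cycle_monom n g"
  then have "exponent_vector n f = exponent_vector n g"
    using keys_cycle_monom by (metis singleton_inject)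
  then show "\<forall>v\<in>{1..n + 2}. f v = g v"
    by (metis lookup_exponent_vector)
next
  assume "\<forall>v\<in>{1..n + 2}. f v = g v"
  then show "cycle_monom n f = cycle_monom n g"
    by (simp add: cycle_monom_def exponent_vector_def)
qed

lemma cycle_monom_mult: "cycle_monom n f \<otimes>\<^bsub>cycle_ring n\<^esub> cycle_monom n g = cycle_monom n (\<lambda>v. f v + g v)"
  by (simp add: cycle_monom_def cycle_ring_def mpoly_ring_def mult_single exponent_vector_def
      sum.distrib single_add)

lemma X_eq_cycle_monom: "v \<in> {1..n + 2} \<Longrightarrow> X v = cycle_monom n (\<lambda>u. if u = v then 1 else 0)"
  by (auto simp: mpoly_var_def cycle_monom_def lookup_exponent_vector lookup_single when_def
      intro!: poly_mapping_eqI arg_cong[where f = "\<lambda>a. Poly_Mapping.single a 1"])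

lemma cring_cycle_ring: "cring (cycle_ring n)"
  unfolding cycle_ring_def by (rule mpoly_ring_cring)

text \<open>The quotient monomial has exponents \<open>f v - g v\<close>; the truncated subtraction
  is exact because \<open>g\<close> divides \<open>f\<close>.\<close>

lemma cycle_monom_mem_ideal:
  assumes "ideal I (cycle_ring n)" "cycle_monom n g \<in> I" "\<And>v. v \<in> {1..n + 2} \<Longrightarrow> g v \<le> f v"
  shows "cycle_monom n f \<in> I"
proof -
  have "cycle_monom n f = cycle_monom n (\<lambda>v. f v - g v) \<otimes>\<^bsub>cycle_ring n\<^esub> cycle_monom n g"
    using assms(3) by (auto simp: cycle_monom_mult cycle_monom_eq_iff)
  then show ?thesis
    using ideal.I_l_closed[OF assms(1,2) cycle_monom_in_carrier] by simp
qed

lemma cycle_monom_mem_ideal_power_Suc: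
  assumes "ideal I (cycle_ring n)" "cycle_monom n g \<in> I"
    and "cycle_monom n (\<lambda>v. f v - g v) \<in> ideal_power (cycle_ring n) I k"
    and "\<And>v. v \<in> {1..n + 2} \<Longrightarrow> g v \<le> f v"
  shows "cycle_monom n f \<in> ideal_power (cycle_ring n) I (Suc k)"
proof -
  have "cycle_monom n f = cycle_monom n (\<lambda>v. f v - g v) \<otimes>\<^bsub>cycle_ring n\<^esub> cycle_monom n g"
    using assms(4) by (auto simp: cycle_monom_mult cycle_monom_eq_iff)
  then show ?thesis
    using cring.mult_mem_ideal_power_Suc[OF cring_cycle_ring assms(3,2)] by simp
qed

section \<open>The edge and cover ideals of a cycle\<close>

text \<open>Edge number \<open>j\<close> joins \<open>j\<close> and its cyclic successor
  \<open>cycle_next n j\<close>, so the closing edge from \<open>n\<close> to \<open>1\<close> needs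
  no separate treatment.\<close>

definition cycle_next :: "nat \<Rightarrow> nat \<Rightarrow> nat"
  where "cycle_next n j = (if j = n then 1 else j + 1)"

definition cycle_edge :: "nat \<Rightarrow> nat \<Rightarrow> nat \<Rightarrow> nat"
  where "cycle_edge n j v = (if v = j \<or> v = cycle_next n j then 1 else 0)"

text \<open>A vertex cover with multiplicities: for \<open>n \<ge> 2\<close> these are the exponents
  of the monomials in the cover ideal.\<close>

definition cycle_cover :: "nat \<Rightarrow> (nat \<Rightarrow> nat) \<Rightarrow> bool"
  where "cycle_cover n f \<longleftrightarrow> (\<forall>j\<in>{1..n}. 1 \<le> f j + f (cycle_next n j))"

lemma cycle_next_in: "j \<in> {1..n} \<Longrightarrow> cycle_next n j \<in> {1..n}"
  by (auto simp: cycle_next_def)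

lemma cycle_next_neq: "2 \<le> n \<Longrightarrow> cycle_next n j \<noteq> j"
  by (auto simp: cycle_next_def)

lemma cycle_edge_ideal_eq:
  assumes "1 \<le> n"
  shows "cycle_edge_ideal n =
    Idl\<^bsub>cycle_ring n\<^esub> ((\<lambda>j. X j \<otimes>\<^bsub>cycle_ring n\<^esub> X (cycle_next n j)) ` {1..n})"
proof -
  have "{1..n} = insert n {1..n - 1}"
    using assms by auto
  then have "(\<lambda>j. X j \<otimes>\<^bsub>cycle_ring n\<^esub> X (cycle_next n j)) ` {1..n} =
      (\<lambda>j. X j \<otimes>\<^bsub>cycle_ring n\<^esub> X (cycle_next n j)) ` {1..n - 1} \<union> {X n \<otimes>\<^bsub>cycle_ring n\<^esub> X 1}"
    by (simp add: cycle_next_def)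
  also have "(\<lambda>j. X j \<otimes>\<^bsub>cycle_ring n\<^esub> X (cycle_next n j)) ` {1..n - 1} =
      (\<lambda>j. X j \<otimes>\<^bsub>cycle_ring n\<^esub> X (j + 1)) ` {1..n - 1}"
    by (intro image_cong) (auto simp: cycle_next_def)
  also have "\<dots> = {X i \<otimes>\<^bsub>cycle_ring n\<^esub> X (i + 1) | i. 1 \<le> i \<and> i \<le> n - 1}"
    unfolding image_def atLeastAtMost_iff Bex_def by blast
  finally show ?thesis
    by (simp add: cycle_edge_ideal_def)
qed

lemma cycle_cover_ideal_eq:
  assumes "1 \<le> n"
  shows "cycle_cover_ideal n = (\<Inter>j\<in>{1..n}. Idl\<^bsub>cycle_ring n\<^esub> {X j, X (cycle_next n j)})"
proof -
  have "{1..n} = insert n {1..n - 1}"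
    using assms by auto
  moreover have "(\<Inter>j\<in>{1..n - 1}. Idl\<^bsub>cycle_ring n\<^esub> {X j, X (cycle_next n j)}) =
      (\<Inter>j\<in>{1..n - 1}. Idl\<^bsub>cycle_ring n\<^esub> {X j, X (j + 1)})"
    by (intro INF_cong) (auto simp: cycle_next_def)
  ultimately show ?thesis
    by (simp add: cycle_cover_ideal_def cycle_next_def)
qed

lemma X_in_carrier: "v \<in> {1..n + 2} \<Longrightarrow> X v \<in> carrier (cycle_ring n)"
  unfolding cycle_ring_def by (rule mpoly_var_in_carrier)

lemma edge_generator:
  assumes "2 \<le> n" "j \<in> {1..n}"
  shows "X j \<otimes>\<^bsub>cycle_ring n\<^esub> X (cycle_next n j) = cycle_monom n (cycle_edge n j)"
  using assms cycle_next_in[of j n] cycle_next_neq[of n j]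
  by (auto simp: X_eq_cycle_monom[of _ n] cycle_monom_mult cycle_monom_eq_iff cycle_edge_def)

lemma ideal_cycle_edge_ideal: "2 \<le> n \<Longrightarrow> ideal (cycle_edge_ideal n) (cycle_ring n)"
proof -
  assume "2 \<le> n"
  interpret cring "cycle_ring n" by (rule cring_cycle_ring)
  show ?thesis
    using \<open>2 \<le> n\<close> by (auto simp: cycle_edge_ideal_eq edge_generator cycle_monom_in_carrier intro!: genideal_ideal)
qed

lemma ideal_gen_edge:
  assumes "j \<in> {1..n}"
  shows "ideal (Idl\<^bsub>cycle_ring n\<^esub> {X j, X (cycle_next n j)}) (cycle_ring n)"
proof -
  interpret cring "cycle_ring n" by (rule cring_cycle_ring)
  show ?thesis
    using assms cycle_next_in[OF assms] by (intro genideal_ideal) (auto intro!: X_in_carrier)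
qed

lemma ideal_cycle_cover_ideal:
  assumes "2 \<le> n"
  shows "ideal (cycle_cover_ideal n) (cycle_ring n)"
proof -
  interpret cring "cycle_ring n" by (rule cring_cycle_ring)
  have "cycle_cover_ideal n = (\<Inter>j\<in>{1..n}. Idl\<^bsub>cycle_ring n\<^esub> {X j, X (cycle_next n j)})"
    using assms by (intro cycle_cover_ideal_eq) simp
  also have "ideal \<dots> (cycle_ring n)"
    using assms by (intro i_Intersect) (auto intro: ideal_gen_edge)
  finally show ?thesis .
qed

section \<open>Monomials lying in the edge and cover ideals\<close>

lemma cycle_monom_mem_cycle_edge_ideal:
  assumes n: "2 \<le> n" and j: "j \<in> {1..n}" and f: "1 \<le> f j" "1 \<le> f (cycle_next n j)"
  shows "cycle_monom n f \<in> cycle_edge_ideal n"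
proof (rule cycle_monom_mem_ideal)
  interpret cring "cycle_ring n" by (rule cring_cycle_ring)
  have "(\<lambda>j. X j \<otimes>\<^bsub>cycle_ring n\<^esub> X (cycle_next n j)) ` {1..n} \<subseteq> cycle_edge_ideal n"
    using n by (subst cycle_edge_ideal_eq)
      (auto intro!: genideal_self simp: edge_generator cycle_monom_in_carrier)
  then show "cycle_monom n (cycle_edge n j) \<in> cycle_edge_ideal n"
    using j edge_generator[OF n j] by (metis image_subset_iff)
  show "ideal (cycle_edge_ideal n) (cycle_ring n)"
    by (rule ideal_cycle_edge_ideal[OF n])
qed (use f in \<open>auto simp: cycle_edge_def\<close>)

lemma cycle_monom_mem_cycle_cover_ideal:
  assumes n: "2 \<le> n" and f: "cycle_cover n f"
  shows "cycle_monom n f \<in> cycle_cover_ideal n"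
proof -
  interpret cring "cycle_ring n" by (rule cring_cycle_ring)
  have "cycle_monom n f \<in> Idl\<^bsub>cycle_ring n\<^esub> {X j, X (cycle_next n j)}" if j: "j \<in> {1..n}" for j
  proof -
    \<comment> \<open>\<open>v\<close> is an endpoint of edge \<open>j\<close> at which
      \<open>f\<close> is positive, so the generator \<open>X v\<close> divides the
      monomial.\<close>
    define v where "v = (if 1 \<le> f j then j else cycle_next n j)"
    have v: "v \<in> {j, cycle_next n j}" "v \<in> {1..n + 2}" "1 \<le> f v"
      using f[unfolded cycle_cover_def, rule_format, OF j] j cycle_next_in[OF j]
      by (auto simp: v_def)
    have "{X j, X (cycle_next n j)} \<subseteq> Idl\<^bsub>cycle_ring n\<^esub> {X j, X (cycle_next n j)}"
      using j cycle_next_in[OF j] by (intro genideal_self) (auto intro!: X_in_carrier)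
    then have "cycle_monom n (\<lambda>u. if u = v then 1 else 0) \<in> Idl\<^bsub>cycle_ring n\<^esub> {X j, X (cycle_next n j)}"
      using v X_eq_cycle_monom[of v n] by auto
    then show ?thesis
      by (rule cycle_monom_mem_ideal[OF ideal_gen_edge[OF j]]) (use v in auto)
  qed
  then show ?thesis
    using n by (auto simp: cycle_cover_ideal_eq)
qed

section \<open>Monomials occurring in elements of the edge and cover ideals\<close>

text \<open>The right-hand side is an ideal containing the generators, hence it contains the ideal
  they generate.\<close>

lemma cycle_edge_ideal_subset:
  assumes "2 \<le> n"
  shows "cycle_edge_ideal n \<subseteq> supported_polys {1..n + 2}
    (\<lambda>a. \<exists>j\<in>{1..n}. \<forall>v. cycle_edge n j v \<le> Poly_Mapping.lookup a v)"
    (is "_ \<subseteq> supported_polys _ ?Q")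
proof -
  interpret cring "cycle_ring n" by (rule cring_cycle_ring)
  have "ideal (supported_polys {1..n + 2} ?Q) (cycle_ring n)"
    unfolding cycle_ring_def by (rule ideal_supported_polys) (auto simp: lookup_add intro: trans_le_add1)
  moreover have "cycle_monom n (cycle_edge n j) \<in> supported_polys {1..n + 2} ?Q" if "j \<in> {1..n}" for j
    using that cycle_next_in[OF that] cycle_monom_in_carrier[of n, unfolded cycle_ring_def]
    by (auto simp: supported_polys_def keys_cycle_monom lookup_exponent_vector cycle_edge_def
        intro!: bexI[of _ j])
  ultimately show ?thesis
    using assms by (subst cycle_edge_ideal_eq, simp, intro genideal_minimal) (auto simp: edge_generator)
qed

lemma cycle_cover_ideal_subset:
  assumes "2 \<le> n"
  shows "cycle_cover_ideal n \<subseteq> supported_polys {1..n + 2} (\<lambda>a. cycle_cover n (Poly_Mapping.lookup a))"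
proof
  interpret cring "cycle_ring n" by (rule cring_cycle_ring)
  fix p assume p: "p \<in> cycle_cover_ideal n"
  have "p \<in> supported_polys {1..n + 2}
      (\<lambda>a. 1 \<le> Poly_Mapping.lookup a j + Poly_Mapping.lookup a (cycle_next n j))"
    (is "_ \<in> supported_polys _ ?Q") if j: "j \<in> {1..n}" for j
  proof -
    have "ideal (supported_polys {1..n + 2} ?Q) (cycle_ring n)"
      unfolding cycle_ring_def by (rule ideal_supported_polys) (auto simp: lookup_add)
    moreover have "{X j, X (cycle_next n j)} \<subseteq> supported_polys {1..n + 2} ?Q"
      using j cycle_next_in[OF j] X_in_carrier[of _ n, unfolded cycle_ring_def]
      by (auto simp: supported_polys_def mpoly_var_def)
    ultimately have "Idl\<^bsub>cycle_ring n\<^esub> {X j, X (cycle_next n j)} \<subseteq> supported_polys {1..n + 2} ?Q"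
      by (rule genideal_minimal)
    then show ?thesis
      using p j assms by (auto simp: cycle_cover_ideal_eq)
  qed
  \<comment> \<open>The carrier condition in \<open>supported_polys\<close> is available only
    through some edge \<open>j\<close>, so the index set has to be nonempty.\<close>
  moreover have "1 \<in> {1..n}"
    using assms by simp
  ultimately show "p \<in> supported_polys {1..n + 2} (\<lambda>a. cycle_cover n (Poly_Mapping.lookup a))"
    by (fastforce simp: supported_polys_def cycle_cover_def)
qed

section \<open>Powers of the ideal \<open>L\<close>\<close>

lemma ideal_cycle_L_ideal:
  assumes "2 \<le> n"
  shows "ideal (cycle_L_ideal n) (cycle_ring n)"
proof -
  interpret cring "cycle_ring n" by (rule cring_cycle_ring)
  show ?thesis
    unfolding cycle_L_ideal_def using assms
    by (intro add_ideals ideal_l_coset ideal_cycle_edge_ideal ideal_cycle_cover_ideal)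
      (auto intro: X_in_carrier)
qed

text \<open>The other summand of \<open>L\<close> contributes zero.\<close>

lemma mult_X_mem_cycle_L_ideal:
  assumes "2 \<le> n"
  shows "p \<in> cycle_edge_ideal n \<Longrightarrow> X (n + 1) \<otimes>\<^bsub>cycle_ring n\<^esub> p \<in> cycle_L_ideal n"
    and "p \<in> cycle_cover_ideal n \<Longrightarrow> X (n + 2) \<otimes>\<^bsub>cycle_ring n\<^esub> p \<in> cycle_L_ideal n"
proof -
  interpret cring "cycle_ring n" by (rule cring_cycle_ring)
  interpret E: ideal "cycle_edge_ideal n" "cycle_ring n" by (rule ideal_cycle_edge_ideal[OF assms])
  interpret C: ideal "cycle_cover_ideal n" "cycle_ring n" by (rule ideal_cycle_cover_ideal[OF assms])
  have X: "X (n + 1) \<in> carrier (cycle_ring n)" "X (n + 2) \<in> carrier (cycle_ring n)"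
    by (auto intro!: X_in_carrier)
  show "X (n + 1) \<otimes>\<^bsub>cycle_ring n\<^esub> p \<in> cycle_L_ideal n" if p: "p \<in> cycle_edge_ideal n"
  proof -
    have "X (n + 1) \<otimes>\<^bsub>cycle_ring n\<^esub> p =
        X (n + 1) \<otimes>\<^bsub>cycle_ring n\<^esub> p \<oplus>\<^bsub>cycle_ring n\<^esub> X (n + 2) \<otimes>\<^bsub>cycle_ring n\<^esub> \<zero>\<^bsub>cycle_ring n\<^esub>"
      using X E.Icarr[OF p] by simp
    then show ?thesis
      using p C.zero_closed unfolding cycle_L_ideal_def set_add_def' l_coset_def by blast
  qed
  show "X (n + 2) \<otimes>\<^bsub>cycle_ring n\<^esub> p \<in> cycle_L_ideal n" if p: "p \<in> cycle_cover_ideal n"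
  proof -
    have "X (n + 2) \<otimes>\<^bsub>cycle_ring n\<^esub> p =
        X (n + 1) \<otimes>\<^bsub>cycle_ring n\<^esub> \<zero>\<^bsub>cycle_ring n\<^esub> \<oplus>\<^bsub>cycle_ring n\<^esub> X (n + 2) \<otimes>\<^bsub>cycle_ring n\<^esub> p"
      using X C.Icarr[OF p] by simp
    then show ?thesis
      using p E.zero_closed unfolding cycle_L_ideal_def set_add_def' l_coset_def by blast
  qed
qed

section \<open>Monomials lying in \<open>L\<close> and its powers\<close>

lemma cycle_monom_mem_cycle_L_ideal_edge:
  assumes "2 \<le> n" "j \<in> {1..n}" "1 \<le> f (n + 1)" "1 \<le> f j" "1 \<le> f (cycle_next n j)"
  shows "cycle_monom n f \<in> cycle_L_ideal n"
proof -
  \<comment> \<open>One factor \<open>X (n + 1)\<close> is divided out; the vertices are at most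
    \<open>n\<close>, so their exponents do not change.\<close>
  have "cycle_monom n f = X (n + 1) \<otimes>\<^bsub>cycle_ring n\<^esub> cycle_monom n (f(n + 1 := f (n + 1) - 1))"
    using assms(3) by (auto simp: X_eq_cycle_monom[of _ n] cycle_monom_mult cycle_monom_eq_iff)
  moreover have "cycle_monom n (f(n + 1 := f (n + 1) - 1)) \<in> cycle_edge_ideal n"
    using assms cycle_next_in[of j n] by (intro cycle_monom_mem_cycle_edge_ideal[of _ j]) auto
  ultimately show ?thesis
    using mult_X_mem_cycle_L_ideal(1)[OF assms(1)] by simp
qed

lemma cycle_monom_mem_cycle_L_ideal_cover:
  assumes "2 \<le> n" "1 \<le> f (n + 2)" "cycle_cover n f"
  shows "cycle_monom n f \<in> cycle_L_ideal n"
proof -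
  have "cycle_monom n f = X (n + 2) \<otimes>\<^bsub>cycle_ring n\<^esub> cycle_monom n (f(n + 2 := f (n + 2) - 1))"
    using assms(2) by (auto simp: X_eq_cycle_monom[of _ n] cycle_monom_mult cycle_monom_eq_iff)
  moreover have "cycle_cover n (f(n + 2 := f (n + 2) - 1))"
    unfolding cycle_cover_def
  proof
    fix j assume j: "j \<in> {1..n}"
    then show "1 \<le> (f(n + 2 := f (n + 2) - 1)) j + (f(n + 2 := f (n + 2) - 1)) (cycle_next n j)"
      using assms(3) cycle_next_in[OF j] by (auto simp: cycle_cover_def)
  qed
  ultimately show ?thesis
    using mult_X_mem_cycle_L_ideal(2)[OF assms(1)] cycle_monom_mem_cycle_cover_ideal[OF assms(1)] by simp
qed

text \<open>The monomial is divisible by \<open>k\<close> copies of \<open>X (n + 2)\<close> times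
  the monomial of the cover \<open>A\<close>, and each copy lies in \<open>L\<close>.\<close>

lemma cycle_monom_mem_cycle_L_power_cover:
  assumes n: "2 \<le> n" and A: "cycle_cover n A"
    and "k \<le> f (n + 2)" "\<And>v. v \<in> {1..n} \<Longrightarrow> k * A v \<le> f v"
  shows "cycle_monom n f \<in> ideal_power (cycle_ring n) (cycle_L_ideal n) k"
  using assms(3,4)
proof (induction k arbitrary: f)
  case 0
  then show ?case
    using cycle_monom_in_carrier by (simp add: ideals_set_def)
next
  case (Suc k)
  \<comment> \<open>\<open>g\<close> is one such copy; \<open>A\<close> is cut off outside the
    vertices, where its values are unconstrained.\<close>
  define g where "g v = (if v \<in> {1..n} then A v else if v = n + 2 then 1 else 0)" for v
  show ?case
  proof (rule cycle_monom_mem_ideal_power_Suc[of _ _ g])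
    show "ideal (cycle_L_ideal n) (cycle_ring n)"
      by (rule ideal_cycle_L_ideal[OF n])
    show "cycle_monom n g \<in> cycle_L_ideal n"
      using A n cycle_next_in[of _ n]
      by (intro cycle_monom_mem_cycle_L_ideal_cover) (auto simp: g_def cycle_cover_def)
    show "cycle_monom n (\<lambda>v. f v - g v) \<in> ideal_power (cycle_ring n) (cycle_L_ideal n) k"
    proof (rule Suc.IH)
      fix v assume v: "v \<in> {1..n}"
      then show "k * A v \<le> f v - g v"
        using Suc.prems(2)[OF v] by (auto simp: g_def)
    qed (use Suc.prems(1) in \<open>auto simp: g_def\<close>)
    fix v assume "v \<in> {1..n + 2}"
    then show "g v \<le> f v"
      using Suc.prems(1) Suc.prems(2)[of v] by (auto simp: g_def)
  qed
qed

text \<open>Of the \<open>k + 2\<close> factors one is an edge times \<open>X (n + 1)\<close>, one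
  is the cover \<open>C\<close> and \<open>k\<close> are the cover \<open>A\<close>, each cover
  times \<open>X (n + 2)\<close>.\<close>

lemma cycle_monom_mem_cycle_L_power:
  assumes n: "2 \<le> n" and j: "j \<in> {1..n}" and A: "cycle_cover n A" and C: "cycle_cover n C"
    and f: "1 \<le> f (n + 1)" "Suc k \<le> f (n + 2)"
      "\<And>v. v \<in> {1..n} \<Longrightarrow> cycle_edge n j v + C v + k * A v \<le> f v"
  shows "cycle_monom n f \<in> ideal_power (cycle_ring n) (cycle_L_ideal n) (Suc (Suc k))"
proof -
  define g where "g v = (if v \<in> {1..n} then cycle_edge n j v else if v = n + 1 then 1 else 0)" for v
  define h where "h v = (if v \<in> {1..n} then C v else if v = n + 2 then 1 else 0)" for v
  note L = ideal_cycle_L_ideal[OF n]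
  have gL: "cycle_monom n g \<in> cycle_L_ideal n"
    using n j cycle_next_in[OF j]
    by (intro cycle_monom_mem_cycle_L_ideal_edge[of n j]) (auto simp: g_def cycle_edge_def)
  have hL: "cycle_monom n h \<in> cycle_L_ideal n"
    using C n cycle_next_in[of _ n]
    by (intro cycle_monom_mem_cycle_L_ideal_cover) (auto simp: h_def cycle_cover_def)
  have gh: "g v + h v \<le> f v" if "v \<in> {1..n + 2}" for v
  proof -
    have "v \<in> {1..n} \<or> v = n + 1 \<or> v = n + 2"
      using that by auto
    then show ?thesis
      using f(1,2) f(3)[of v] by (auto simp: g_def h_def)
  qed
  have "cycle_monom n (\<lambda>v. f v - g v - h v) \<in> ideal_power (cycle_ring n) (cycle_L_ideal n) k"
  proof (rule cycle_monom_mem_cycle_L_power_cover[OF n A])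
    fix v assume v: "v \<in> {1..n}"
    then show "k * A v \<le> f v - g v - h v"
      using f(3)[OF v] by (auto simp: g_def h_def)
  qed (use f(2) in \<open>auto simp: g_def h_def\<close>)
  then have "cycle_monom n (\<lambda>v. f v - g v) \<in> ideal_power (cycle_ring n) (cycle_L_ideal n) (Suc k)"
    by (rule cycle_monom_mem_ideal_power_Suc[OF L hL]) (use gh in force)
  then show ?thesis
    by (rule cycle_monom_mem_ideal_power_Suc[OF L gL]) (use gh in \<open>blast intro: add_leD1\<close>)
qed

text \<open>A necessary condition on the exponents \<open>f\<close> of a monomial in \<open>L\<^sup>k\<close>, in the summand
  \<open>y\<^sup>a z\<^sup>b I\<^sup>a J\<^sup>b\<close>. Of the \<open>a\<close> edges only one is kept.\<close>
definition L_power_exponents :: "nat \<Rightarrow> nat \<Rightarrow> (nat \<Rightarrow> nat) \<Rightarrow> bool"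
  where "L_power_exponents n k f \<longleftrightarrow> (\<exists>a b. a + b = k \<and> a \<le> f (n + 1) \<and> b \<le> f (n + 2) \<and>
    (\<forall>t\<in>{1..n}. b \<le> f t + f (cycle_next n t)) \<and>
    (1 \<le> a \<longrightarrow> (\<exists>j\<in>{1..n}. \<forall>t\<in>{1..n}. b + cycle_edge n j t + cycle_edge n j (cycle_next n t)
      \<le> f t + f (cycle_next n t))))"

text \<open>The numbers of edge and cover factors add up. If an edge has to be exhibited, it comes
  from a factor that has one, and the other factor contributes only its degree bound.\<close>

lemma L_power_exponents_add:
  assumes "L_power_exponents n k f" "L_power_exponents n l g"
  shows "L_power_exponents n (k + l) (\<lambda>v. f v + g v)"
proof -
  let ?s = "cycle_next n"
  obtain a b where f: "a + b = k" "a \<le> f (n + 1)" "b \<le> f (n + 2)"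
      "\<forall>t\<in>{1..n}. b \<le> f t + f (?s t)"
      "1 \<le> a \<longrightarrow> (\<exists>j\<in>{1..n}. \<forall>t\<in>{1..n}. b + cycle_edge n j t + cycle_edge n j (?s t) \<le> f t + f (?s t))"
    using assms(1) unfolding L_power_exponents_def by blast
  obtain c d where g: "c + d = l" "c \<le> g (n + 1)" "d \<le> g (n + 2)"
      "\<forall>t\<in>{1..n}. d \<le> g t + g (?s t)"
      "1 \<le> c \<longrightarrow> (\<exists>j\<in>{1..n}. \<forall>t\<in>{1..n}. d + cycle_edge n j t + cycle_edge n j (?s t) \<le> g t + g (?s t))"
    using assms(2) unfolding L_power_exponents_def by blast
  have "\<exists>j\<in>{1..n}. \<forall>t\<in>{1..n}. b + d + cycle_edge n j t + cycle_edge n j (?s t)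
      \<le> (f t + g t) + (f (?s t) + g (?s t))" if "1 \<le> a + c"
  proof (cases "1 \<le> a")
    case True
    then obtain j where j: "j \<in> {1..n}"
        "\<forall>t\<in>{1..n}. b + cycle_edge n j t + cycle_edge n j (?s t) \<le> f t + f (?s t)"
      using f(5) by blast
    show ?thesis
    proof (intro bexI[of _ j] ballI)
      fix t assume "t \<in> {1..n}"
      then show "b + d + cycle_edge n j t + cycle_edge n j (?s t) \<le> (f t + g t) + (f (?s t) + g (?s t))"
        using j(2)[rule_format, of t] g(4)[rule_format, of t] by linarith
    qed (rule j)
  next
    case False
    with that have "1 \<le> c"
      by simp
    then obtain j where j: "j \<in> {1..n}"
        "\<forall>t\<in>{1..n}. d + cycle_edge n j t + cycle_edge n j (?s t) \<le> g t + g (?s t)"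
      using g(5) \<open>1 \<le> c\<close> by blast
    show ?thesis
    proof (intro bexI[of _ j] ballI)
      fix t assume "t \<in> {1..n}"
      then show "b + d + cycle_edge n j t + cycle_edge n j (?s t) \<le> (f t + g t) + (f (?s t) + g (?s t))"
        using j(2)[rule_format, of t] f(4)[rule_format, of t] by linarith
    qed (rule j)
  qed
  moreover have "b + d \<le> (f t + g t) + (f (?s t) + g (?s t))" if "t \<in> {1..n}" for t
    using f(4)[rule_format, OF that] g(4)[rule_format, OF that] by linarith
  ultimately show ?thesis
    using f(1-3) g(1-3) unfolding L_power_exponents_def
    by (intro exI[where x = "b + d", THEN exI[where x = "a + c"]]) auto
qed

lemma L_power_exponents_0: "L_power_exponents n 0 f"
  by (simp add: L_power_exponents_def)

lemma X_in_supported_polys: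
  "v \<in> V \<Longrightarrow> X v \<in> supported_polys V (\<lambda>a. 1 \<le> Poly_Mapping.lookup a v)"
  using mpoly_var_in_carrier[of v V] by (auto simp: supported_polys_def mpoly_var_def)

text \<open>An element of \<open>L\<close> is \<open>X (n + 1) * q + X (n + 2) * r\<close>; the
  first summand gives \<open>a = 1\<close>, \<open>b = 0\<close>, the second \<open>a = 0\<close>,
  \<open>b = 1\<close>.\<close>

lemma cycle_L_ideal_subset:
  assumes "2 \<le> n"
  shows "cycle_L_ideal n \<subseteq>
    supported_polys {1..n + 2} (\<lambda>a. L_power_exponents n 1 (Poly_Mapping.lookup a))"
    (is "_ \<subseteq> supported_polys ?V ?Q")
proof
  fix p assume "p \<in> cycle_L_ideal n"
  then obtain q r where q: "q \<in> cycle_edge_ideal n" and r: "r \<in> cycle_cover_ideal n"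
    and p: "p = X (n + 1) * q + X (n + 2) * r"
    by (auto simp: cycle_L_ideal_def set_add_def' l_coset_def cycle_ring_def mpoly_ring_def)
  have "X (n + 1) * q \<in> supported_polys ?V ?Q"
  proof (rule supported_polys_mult)
    show "X (n + 1) \<in> supported_polys ?V (\<lambda>a. 1 \<le> Poly_Mapping.lookup a (n + 1))"
      by (rule X_in_supported_polys) auto
    show "q \<in> supported_polys ?V (\<lambda>a. \<exists>j\<in>{1..n}. \<forall>v. cycle_edge n j v \<le> Poly_Mapping.lookup a v)"
      using q cycle_edge_ideal_subset[OF assms] by blast
  next
    fix a b :: "nat \<Rightarrow>\<^sub>0 nat"
    assume a: "1 \<le> Poly_Mapping.lookup a (n + 1)"
      and "\<exists>j\<in>{1..n}. \<forall>v. cycle_edge n j v \<le> Poly_Mapping.lookup b v"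
    then obtain j where "j \<in> {1..n}" and j: "\<And>v. cycle_edge n j v \<le> Poly_Mapping.lookup b v"
      by blast
    moreover have "cycle_edge n j t + cycle_edge n j (cycle_next n t)
        \<le> Poly_Mapping.lookup (a + b) t + Poly_Mapping.lookup (a + b) (cycle_next n t)" for t
      unfolding lookup_add using j[of t] j[of "cycle_next n t"] by linarith
    ultimately have "\<exists>j\<in>{1..n}. \<forall>t\<in>{1..n}. 0 + cycle_edge n j t + cycle_edge n j (cycle_next n t)
        \<le> Poly_Mapping.lookup (a + b) t + Poly_Mapping.lookup (a + b) (cycle_next n t)"
      by (intro bexI[of _ j]) simp_all
    moreover have "1 \<le> Poly_Mapping.lookup (a + b) (n + 1)"
      using a by (simp add: lookup_add)
    ultimately show "L_power_exponents n 1 (Poly_Mapping.lookup (a + b))"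
      unfolding L_power_exponents_def by (intro exI[where x = 0, THEN exI[where x = 1]]) simp
  qed
  moreover have "X (n + 2) * r \<in> supported_polys ?V ?Q"
  proof (rule supported_polys_mult)
    show "X (n + 2) \<in> supported_polys ?V (\<lambda>a. 1 \<le> Poly_Mapping.lookup a (n + 2))"
      by (rule X_in_supported_polys) auto
    show "r \<in> supported_polys ?V (\<lambda>a. cycle_cover n (Poly_Mapping.lookup a))"
      using r cycle_cover_ideal_subset[OF assms] by blast
  next
    fix a b :: "nat \<Rightarrow>\<^sub>0 nat"
    assume a: "1 \<le> Poly_Mapping.lookup a (n + 2)" and b: "cycle_cover n (Poly_Mapping.lookup b)"
    have "1 \<le> Poly_Mapping.lookup (a + b) t + Poly_Mapping.lookup (a + b) (cycle_next n t)"
      if "t \<in> {1..n}" for t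
      using b that unfolding lookup_add cycle_cover_def by fastforce
    then show "L_power_exponents n 1 (Poly_Mapping.lookup (a + b))"
      using a unfolding L_power_exponents_def
      by (intro exI[where x = 1, THEN exI[where x = 0]]) (auto simp: lookup_add)
  qed
  ultimately show "p \<in> supported_polys ?V ?Q"
    unfolding p by (rule supported_polys_add)
qed

lemma cycle_L_power_subset:
  assumes "2 \<le> n"
  shows "ideal_power (cycle_ring n) (cycle_L_ideal n) k \<subseteq>
    supported_polys {1..n + 2} (\<lambda>a. L_power_exponents n k (Poly_Mapping.lookup a))"
  unfolding cycle_ring_def
proof (rule ideal_power_subset_supported_polys)
  show "L_power_exponents n (Suc k) (Poly_Mapping.lookup (a + b))"
    if "L_power_exponents n k (Poly_Mapping.lookup a)" "L_power_exponents n 1 (Poly_Mapping.lookup b)"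
    for k a b
    using L_power_exponents_add[OF that] by (simp add: lookup_add[abs_def])
qed (use cycle_L_ideal_subset[OF assms] L_power_exponents_0 in auto)

section \<open>The witnesses\<close>

text \<open>\<open>M\<close> gives the vertex exponents of the witness. The assumption
  \<open>M\<close> splits its square into two products of one edge and \<open>k + 1\<close> covers;
  by \<open>not_M\<close>, removing any edge leaves some edge with degree below
  \<open>k + 1\<close>.\<close>

lemma cycle_L_power_not_integrally_closed:
  assumes n: "2 \<le> n" and A: "cycle_cover n A" and C: "cycle_cover n C"
    and i: "i \<in> {1..n}" and j: "j \<in> {1..n}"
    and M: "\<And>v. v \<in> {1..n} \<Longrightarrow>
      cycle_edge n i v + cycle_edge n j v + C v + (2 * k + 1) * A v \<le> 2 * M v"
    and not_M: "\<And>j. j \<in> {1..n} \<Longrightarrow> \<exists>t\<in>{1..n}. M t + M (cycle_next n t)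
      < Suc k + cycle_edge n j t + cycle_edge n j (cycle_next n t)"
  shows "\<not> integrally_closed_ideal (cycle_ring n)
    (ideal_power (cycle_ring n) (cycle_L_ideal n) (Suc (Suc k)))"
    (is "\<not> integrally_closed_ideal ?R ?I")
proof -
  interpret cring ?R by (rule cring_cycle_ring)
  define f where "f v = (if v \<in> {1..n} then M v else if v = n + 1 then 1 else Suc k)" for v
  \<comment> \<open>\<open>g\<close> takes edge \<open>i\<close> and \<open>k + 1\<close> copies of
    \<open>A\<close>; its cofactor in the square retains edge \<open>j\<close>, \<open>C\<close> and
    \<open>k\<close> copies of \<open>A\<close>.\<close>
  define g where "g v = (if v \<in> {1..n} then cycle_edge n i v + A v + k * A v
    else if v = n + 1 then 1 else Suc k)" for v
  have le: "g v \<le> 2 * f v" if "v \<in> {1..n + 2}" for v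
    using M[of v] that by (auto simp: f_def g_def)
  have g: "cycle_monom n g \<in> ?I"
    by (rule cycle_monom_mem_cycle_L_power[OF n i A A]) (auto simp: g_def)
  have h: "cycle_monom n (\<lambda>v. 2 * f v - g v) \<in> ?I"
  proof (rule cycle_monom_mem_cycle_L_power[OF n j A C])
    fix v assume v: "v \<in> {1..n}"
    then show "cycle_edge n j v + C v + k * A v \<le> 2 * f v - g v"
      using M[OF v] by (auto simp: f_def g_def)
  qed (auto simp: f_def g_def)
  have "cycle_monom n f \<otimes>\<^bsub>?R\<^esub> cycle_monom n f = cycle_monom n g \<otimes>\<^bsub>?R\<^esub> cycle_monom n (\<lambda>v. 2 * f v - g v)"
    using le by (simp add: cycle_monom_mult cycle_monom_eq_iff)
  then have "integral_over_ideal ?R ?I (cycle_monom n f)"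
    by (intro integral_over_ideal_of_square[OF _ g h] ideal_ideal_power ideal_cycle_L_ideal n
        cycle_monom_in_carrier)
  moreover have "cycle_monom n f \<notin> ?I"
  proof
    assume "cycle_monom n f \<in> ?I"
    then have "L_power_exponents n (Suc (Suc k)) (Poly_Mapping.lookup (exponent_vector n f))"
      using cycle_L_power_subset[OF n] by (fastforce simp: supported_polys_def keys_cycle_monom)
    then obtain a b where ab: "a + b = Suc (Suc k)" "a \<le> 1" "b \<le> Suc k"
      and "1 \<le> a \<longrightarrow> (\<exists>j\<in>{1..n}. \<forall>t\<in>{1..n}. b + cycle_edge n j t + cycle_edge n j (cycle_next n t)
        \<le> Poly_Mapping.lookup (exponent_vector n f) t
          + Poly_Mapping.lookup (exponent_vector n f) (cycle_next n t))"
      unfolding L_power_exponents_def by (auto simp: lookup_exponent_vector f_def)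
    \<comment> \<open>The witness has degree \<open>1\<close> in \<open>X (n + 1)\<close> and
      \<open>k + 1\<close> in \<open>X (n + 2)\<close>. These add up to the power, so both bounds
      are attained.\<close>
    moreover have "b = Suc k" "1 \<le> a"
      using ab by auto
    ultimately obtain j where j: "j \<in> {1..n}" "\<And>t. t \<in> {1..n} \<Longrightarrow>
        Suc k + cycle_edge n j t + cycle_edge n j (cycle_next n t)
        \<le> Poly_Mapping.lookup (exponent_vector n f) t
          + Poly_Mapping.lookup (exponent_vector n f) (cycle_next n t)"
      by blast
    obtain t where t: "t \<in> {1..n}"
        "M t + M (cycle_next n t) < Suc k + cycle_edge n j t + cycle_edge n j (cycle_next n t)"
      using not_M[OF j(1)] by blast
    show False
      using j(2)[OF t(1)] t cycle_next_in[OF t(1)] by (auto simp: lookup_exponent_vector f_def)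
  qed
  ultimately show ?thesis
    by (auto simp: integrally_closed_ideal_def integral_closure_ideal_def)
qed

text \<open>\<open>?A\<close> and \<open>?C\<close> are the colour classes of the bipartite cycle.
  At every vertex \<open>2 * ?M - ?C - (2 * k + 1) * ?A\<close> is \<open>1\<close>, which leaves
  room for two disjoint edges.\<close>

lemma even_cycle_L_power_not_integrally_closed:
  assumes n: "even n" "4 \<le> n"
  shows "\<not> integrally_closed_ideal (cycle_ring n)
    (ideal_power (cycle_ring n) (cycle_L_ideal n) (Suc (Suc k)))"
proof (rule cycle_L_power_not_integrally_closed)
  let ?A = "\<lambda>v::nat. if even v then 1 else 0 :: nat"
  let ?C = "\<lambda>v::nat. if even v then 0 else 1 :: nat"
  let ?M = "\<lambda>v::nat. if even v then Suc k else 1"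
  have parity: "even (cycle_next n j) \<longleftrightarrow> odd j" for j
    using n by (auto simp: cycle_next_def)
  show "cycle_cover n ?A" "cycle_cover n ?C"
    by (simp_all add: cycle_cover_def parity)
  show "1 \<in> {1..n}" "3 \<in> {1..n}"
    using n by auto
  show "cycle_edge n 1 v + cycle_edge n 3 v + ?C v + (2 * k + 1) * ?A v \<le> 2 * ?M v" for v
  proof -
    have "cycle_edge n 1 v + cycle_edge n 3 v \<le> 1"
      using n by (simp add: cycle_edge_def cycle_next_def)
    then show ?thesis
      by auto
  qed
  show "\<exists>t\<in>{1..n}. ?M t + ?M (cycle_next n t)
      < Suc k + cycle_edge n j t + cycle_edge n j (cycle_next n t)" if "j \<in> {1..n}" for j
    \<comment> \<open>Edge \<open>j\<close> meets itself in two vertices, but its degree in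
      \<open>?M\<close> is \<open>k + 2\<close>, less than \<open>k + 3\<close>.\<close>
    using that by (intro bexI[of _ j]) (simp_all add: cycle_edge_def parity)
qed (use n in simp)

text \<open>The colouring by parity fails only at the closing edge: \<open>?A\<close> adds
  \<open>1\<close> to the even vertices, \<open>?C\<close> replaces \<open>n\<close> by
  \<open>n - 1\<close> among the odd ones. Now \<open>2 * ?M - ?C - (2 * k + 1) * ?A\<close> is
  \<open>0\<close> at \<open>1\<close>, \<open>n - 1\<close>, \<open>n\<close> and \<open>1\<close>
  elsewhere. As \<open>n \<ge> 7\<close>, the edges \<open>{2, 3}\<close> and \<open>{4, 5}\<close>
  avoid these three vertices.\<close>

lemma odd_cycle_L_power_not_integrally_closed:
  assumes n: "odd n" "7 \<le> n"
  shows "\<not> integrally_closed_ideal (cycle_ring n)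
    (ideal_power (cycle_ring n) (cycle_L_ideal n) (Suc (Suc k)))"
proof (rule cycle_L_power_not_integrally_closed)
  let ?A = "\<lambda>v::nat. if v = 1 \<or> even v then 1 else 0 :: nat"
  let ?C = "\<lambda>v::nat. if v = n - 1 \<or> odd v \<and> v \<noteq> n then 1 else 0 :: nat"
  let ?M = "\<lambda>v::nat. if v = 1 \<or> even v then Suc k else if v = n then 0 else 1"
  have parity: "even (cycle_next n j) \<longleftrightarrow> odd j \<and> j \<noteq> n" for j
    using n by (auto simp: cycle_next_def)
  have next_n: "cycle_next n n = 1"
    by (simp add: cycle_next_def)
  have next_eq_1: "cycle_next n j = 1 \<longleftrightarrow> j = n" if "1 \<le> j" for j
    using that by (simp add: cycle_next_def)
  have next_eq_n: "cycle_next n j = n \<longleftrightarrow> j = n - 1" for j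
    using n by (auto simp: cycle_next_def)
  have "1 \<le> ?A j + ?A (cycle_next n j)" for j
    by (cases "j = n") (simp_all add: next_n parity)
  then show "cycle_cover n ?A"
    by (simp add: cycle_cover_def)
  have "1 \<le> ?C j + ?C (cycle_next n j)" for j
  proof (cases "j = n")
    case True
    then show ?thesis
      using n by (simp add: next_n)
  next
    case False
    then show ?thesis
      by (simp add: parity next_eq_n)
  qed
  then show "cycle_cover n ?C"
    by (simp add: cycle_cover_def)
  show "2 \<in> {1..n}" "4 \<in> {1..n}"
    using n by auto
  show "cycle_edge n 2 v + cycle_edge n 4 v + ?C v + (2 * k + 1) * ?A v \<le> 2 * ?M v" for v
  proof -
    have edges: "cycle_edge n 2 u = (if u = 2 \<or> u = 3 then 1 else 0)"
        "cycle_edge n 4 u = (if u = 4 \<or> u = 5 then 1 else 0)" for u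
      using n by (simp_all add: cycle_edge_def cycle_next_def)
    consider "v = 1" | "v = n" | "v = n - 1" | "even v" "v \<noteq> n - 1" | "odd v" "v \<noteq> 1" "v \<noteq> n"
      by blast
    then show ?thesis
    proof cases
      case 4
      then have "cycle_edge n 2 v + cycle_edge n 4 v \<le> 1"
        by (simp add: edges)
      then show ?thesis
        using 4 by simp
    next
      case 5
      then have "cycle_edge n 2 v + cycle_edge n 4 v \<le> 1" "v \<noteq> n - 1"
        using n by (auto simp: edges)
      then show ?thesis
        using 5 by simp
    qed (use n in \<open>auto simp: edges\<close>)
  qed
  show "\<exists>t\<in>{1..n}. ?M t + ?M (cycle_next n t)
      < Suc k + cycle_edge n j t + cycle_edge n j (cycle_next n t)" if j: "j \<in> {1..n}" for j
  \<comment> \<open>Edges \<open>1\<close> and \<open>n\<close> both contain vertex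
    \<open>1\<close>, and the closing edge has degree only \<open>k + 1\<close> in
    \<open>?M\<close>. Any other edge obstructs itself, having degree at most
    \<open>k + 2\<close>.\<close>
  proof (cases "j = 1 \<or> j = n")
    case True
    then show ?thesis
      using n by (intro bexI[of _ n]) (auto simp: cycle_edge_def next_n)
  next
    case False
    then show ?thesis
      using j by (intro bexI[of _ j]) (auto simp: cycle_edge_def parity next_eq_1[unfolded One_nat_def])
  qed
qed (use n in simp)

theorem theorem4p3:
  fixes n i :: nat
  assumes "(even n \<and> n \<ge> 4) \<or> (odd n \<and> n \<ge> 7)"
    and "i \<ge> 3"
  shows "\<not> integrally_closed_ideal (cycle_ring n) (ideal_power (cycle_ring n) (cycle_L_ideal n) i)"
proof -
  have "i = Suc (Suc (i - 2))"
    using assms(2) by simp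
  then show ?thesis
    using assms(1) even_cycle_L_power_not_integrally_closed odd_cycle_L_power_not_integrally_closed
    by metis
qed

end
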